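(* Let $(A;*,\{a_n\})$ be a Kauffman bracket magma, let $P:\mathcal{L}^{fr}\to A$ be its associated framed link invariant, and let $\mathrm{Map}(A)$ be the set of all maps from $A$ to itself. Assume that there is a map $\rho:\mathcal{L}^{fr}\to \mathrm{Map}(A)$, written $\rho(D)=\rho_D$ for a link diagram $D$, such that $$\rho_D(P(D))=\rho_{D'}(P(D'))$$ whenever $D$ and $D'$ are link diagrams such that $D'$ is obtained from $D$ by applying once a (positive or negative) Reidemeister move I. Then there exists a unique invariant $P^{\rho}:\mathcal{L}\to A$ of links defined by $P^{\rho}(D)=\rho_D(P(D))$ for every link diagram $D$.
   Context: $\mathbb{N}=\{1,2,3,\dots\}$. A magma $(A;* )$ (a set with a binary operation) is entropic if $(a*b)*(c*d)=(a*c)*(b*d)$ for all $a,b,c,d\in A$. A Kauffman bracket magma $(A;*,\{a_n\})$ is an entropic magma $(A;* )$ together with a sequence $\{a_n\}_{n=1}^\infty$ of not necessarily distinct elements of $A$ such that, for all $n\in\mathbb{N}$, (1) $(a_{n+1}*a_{n+2})*(a_n*a_{n+1})=a_n$, and (2) $(a_n*a_{n+1})*(a_{n+1}*a_n)=a_{n+1}$. Link diagrams are (unoriented) diagrams in the plane. $\mathcal{L}^{fr}$ is the set of equivalence classes of unoriented link diagrams under (planar isotopy and) Reidemeister moves II and III; $\mathcal{L}$ is the set of equivalence classes of link diagrams under all Reidemeister moves I, II, III. A map defined on $\mathcal{L}^{fr}$ or $\mathcal{L}$ is evaluated on a diagram through its class. A Kauffman skein triple $(D,D_0,D_\infty)$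 consists of three diagrams identical except near one crossing of $D$, where $D_0$ is obtained by the $A$-smoothing (joining the two regions swept out when the overstrand is rotated counterclockwise) and $D_\infty$ by the other ($B$-)smoothing. Known theorem (Niebrzydowski–Przytycki): for a Kauffman bracket magma $(A;*,\{a_n\})$ there is a unique map $P:\mathcal{L}^{fr}\to A$ with $P(T_n)=a_n$, where $T_n$ is the trivial (crossingless) link diagram with $n$ components, and $P(D)=P(D_0)*P(D_\infty)$ for every Kauffman skein triple. This $P$ is the invariant used in the statement. A positive or negative Reidemeister move I adds or removes a single kink of either crossing type. *)

theory Defs
  imports "HOL-Analysis.Analysis"
begin

section \<open>Kauffman bracket magmas\<close>

text \<open>The sequence is indexed by the positive integers; the value \<open>a 0\<close> is never used.\<close>

locale entropic_magma =
  fixes opr :: "'a \<Rightarrow> 'a \<Rightarrow> 'a"  (infixl \<open>\<star>\<close> 70)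
  assumes entropic: "(a \<star> b) \<star> (c \<star> d) = (a \<star> c) \<star> (b \<star> d)"

locale kauffman_bracket_magma = entropic_magma opr
  for opr :: "'a \<Rightarrow> 'a \<Rightarrow> 'a"  (infixl \<open>\<star>\<close> 70) +
  fixes a :: "nat \<Rightarrow> 'a"
  assumes kbm1: "n \<ge> 1 \<Longrightarrow> (a (n + 1) \<star> a (n + 2)) \<star> (a n \<star> a (n + 1)) = a n"
    and kbm2: "n \<ge> 1 \<Longrightarrow> (a n \<star> a (n + 1)) \<star> (a (n + 1) \<star> a n) = a (n + 1)"


section \<open>Link diagrams in the plane\<close>

text \<open>
  An unoriented link diagram is a nonempty compact subset of the plane that is locally either an
  arc or a transverse crossing of two arcs (its shadow), together with a choice of an overstrand at
  every crossing.  The overstrand at a crossing \<open>p\<close> is recorded through its germ, that is, the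
  filter \<open>at p within S\<close> for any small piece \<open>S\<close> of that strand.  At all other points of the plane
  the crossing information is the trivial filter \<open>bot\<close>, so that a point \<open>p\<close> is a crossing if and
  only if its filter differs from \<open>bot\<close>.
\<close>

definition arc_point :: "complex set \<Rightarrow> (complex \<Rightarrow> complex filter) \<Rightarrow> complex \<Rightarrow> bool" where
  "arc_point K ov p \<longleftrightarrow>
     (\<exists>U h g. open U \<and> p \<in> U \<and> homeomorphism U (ball 0 1) h g \<and> h p = 0 \<and>
        h ` (K \<inter> U) = {w \<in> ball 0 1. Im w = 0} \<and> ov p = bot)"

definition crossing_point :: "complex set \<Rightarrow> (complex \<Rightarrow> complex filter) \<Rightarrow> complex \<Rightarrow> bool" where
  "crossing_point K ov p \<longleftrightarrow>
     (\<exists>U h g. open U \<and> p \<in> U \<and> homeomorphism U (ball 0 1) h g \<and> h p = 0 \<and>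
        h ` (K \<inter> U) = {w \<in> ball 0 1. Im w = 0 \<or> Re w = 0} \<and>
        ov p = at p within {z \<in> U. Im (h z) = 0})"

definition is_link_diagram :: "complex set \<Rightarrow> (complex \<Rightarrow> complex filter) \<Rightarrow> bool" where
  "is_link_diagram K ov \<longleftrightarrow>
     compact K \<and> K \<noteq> {} \<and>
     (\<forall>p\<in>K. arc_point K ov p \<or> crossing_point K ov p) \<and>
     (\<forall>p. p \<notin> K \<longrightarrow> ov p = bot)"

lemma is_link_diagram_circle: "is_link_diagram (sphere 0 1) (\<lambda>_. bot)"
proof -
  have "arc_point (sphere 0 1) (\<lambda>_. bot) p" if p: "p \<in> sphere 0 1" for p
  proof -
    define g where "g = (\<lambda>w. p * exp (\<i> * w))"
    define h where "h = (\<lambda>z. - \<i> * Ln (z / p))"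
    define U where "U = g ` ball 0 1"
    have p0: "p \<noteq> 0" and np: "norm p = 1" using p by auto
    have hg: "h (g w) = w" if "w \<in> ball 0 1" for w
    proof -
      have "\<bar>Im (\<i> * w)\<bar> < 1" using that abs_Re_le_cmod[of w] by auto
      then have "-pi < Im (\<i> * w)" "Im (\<i> * w) \<le> pi" using pi_gt3 by linarith+
      then have "Ln (exp (\<i> * w)) = \<i> * w" by (rule Ln_exp)
      then show ?thesis using p0 by (simp add: h_def g_def flip: mult.assoc)
    qed
    have cg: "continuous_on (ball 0 1) g" unfolding g_def by (intro continuous_intros)
    have inj: "inj_on g (ball 0 1)" by (rule inj_on_inverseI[of _ h]) (rule hg)
    have U: "open U" unfolding U_def by (rule invariance_of_domain[OF cg _ inj]) simp
    obtain h' where h': "homeomorphism (ball 0 1) U g h'"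
      using invariance_of_domain_homeomorphism[OF _ cg _ inj] U_def by auto
    have "h z = h' z" if "z \<in> U" for z
      using that hg h' unfolding U_def homeomorphism_def by auto
    then have hom: "homeomorphism U (ball 0 1) h g"
      using homeomorphism_cong[OF _ refl refl] h' homeomorphism_symD
      by (metis homeomorphism_cong)
    have g0: "g 0 = p" by (simp add: g_def)
    have nrm: "norm (g w) = 1 \<longleftrightarrow> Im w = 0" for w
      by (simp add: g_def norm_mult np norm_exp_eq_Re)
    have pU: "p \<in> U" unfolding U_def using g0 by (metis centre_in_ball image_eqI zero_less_one)
    have hp: "h p = 0" using hg[of 0] g0 by simp
    have "sphere 0 1 \<inter> U = g ` {w \<in> ball 0 1. Im w = 0}"
      unfolding U_def using nrm by auto
    then have "h ` (sphere 0 1 \<inter> U) = (\<lambda>w. h (g w)) ` {w \<in> ball 0 1. Im w = 0}"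
      by (simp add: image_image)
    also have "\<dots> = {w \<in> ball 0 1. Im w = 0}" using hg by force
    finally show ?thesis unfolding arc_point_def using U pU hom hp by blast
  qed
  then show ?thesis by (auto simp: is_link_diagram_def)
qed

typedef link_diagram =
  "{(K :: complex set, ov :: complex \<Rightarrow> complex filter). is_link_diagram K ov}"
  using is_link_diagram_circle by blast

definition shadow :: "link_diagram \<Rightarrow> complex set" where
  "shadow D = fst (Rep_link_diagram D)"

definition over :: "link_diagram \<Rightarrow> complex \<Rightarrow> complex filter" where
  "over D = snd (Rep_link_diagram D)"

definition trivial_diagram :: "nat \<Rightarrow> link_diagram \<Rightarrow> bool" where
  "trivial_diagram n D \<longleftrightarrow> (\<forall>p. over D p = bot) \<and> card (components (shadow D)) = n"


section \<open>Planar isotopy and local changes\<close>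

text \<open>The final homeomorphisms of ambient isotopies of the plane; in particular they preserve the
  orientation of the plane.\<close>

definition plane_isotopy :: "(complex \<Rightarrow> complex) \<Rightarrow> bool" where
  "plane_isotopy \<phi> \<longleftrightarrow>
     (\<exists>H :: real \<times> complex \<Rightarrow> complex.
        continuous_on ({0..1} \<times> UNIV) H \<and>
        (\<forall>t\<in>{0..1}. \<exists>g. homeomorphism UNIV UNIV (\<lambda>z. H (t, z)) g) \<and>
        (\<forall>z. H (0, z) = z) \<and> (\<forall>z. H (1, z) = \<phi> z))"

definition planar_isotopic :: "link_diagram \<Rightarrow> link_diagram \<Rightarrow> bool" where
  "planar_isotopic D D' \<longleftrightarrow>
     (\<exists>\<phi>. plane_isotopy \<phi> \<and> shadow D' = \<phi> ` shadow D \<and>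
        (\<forall>p. over D' (\<phi> p) = filtermap \<phi> (over D p)))"

text \<open>
  Reidemeister moves and smoothings replace a piece of a diagram inside a disc.  The pieces
  are drawn in the square \<open>frame\<close>, which is then placed in the plane by an arbitrary
  \<open>\<phi>\<close> with \<open>plane_isotopy \<phi>\<close>.
\<close>

type_synonym picture = "complex set \<times> (complex \<Rightarrow> complex filter)"

definition frame :: "complex set" where
  "frame = cbox (Complex (-2) (-2)) (Complex 2 2)"

definition contains_picture :: "(complex \<Rightarrow> complex) \<Rightarrow> picture \<Rightarrow> link_diagram \<Rightarrow> bool" where
  "contains_picture \<phi> T D \<longleftrightarrow>
     shadow D \<inter> \<phi> ` frame = \<phi> ` fst T \<and>
     (\<forall>p\<in>frame. over D (\<phi> p) = filtermap \<phi> (snd T p))"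

definition agree_outside :: "(complex \<Rightarrow> complex) \<Rightarrow> link_diagram \<Rightarrow> link_diagram \<Rightarrow> bool" where
  "agree_outside \<phi> D D' \<longleftrightarrow>
     shadow D - \<phi> ` frame = shadow D' - \<phi> ` frame \<and>
     (\<forall>p. p \<notin> \<phi> ` frame \<longrightarrow> over D p = over D' p)"

definition replace_picture :: "picture \<Rightarrow> picture \<Rightarrow> link_diagram \<Rightarrow> link_diagram \<Rightarrow> bool" where
  "replace_picture T T' D D' \<longleftrightarrow>
     (\<exists>\<phi>. plane_isotopy \<phi> \<and> contains_picture \<phi> T D \<and> contains_picture \<phi> T' D' \<and>
        agree_outside \<phi> D D')"

text \<open>
  \<open>layered [S\<^sub>1, \<dots>, S\<^sub>k]\<close> is the picture with strands \<open>S\<^sub>1, \<dots>, S\<^sub>k\<close> listed from top to bottom;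
  its crossings are the points lying on two of the strands.
\<close>

fun layered_over :: "complex set list \<Rightarrow> complex \<Rightarrow> complex filter" where
  "layered_over [] p = bot"
| "layered_over (S # Ss) p =
     (if p \<in> S then (if p \<in> \<Union>(set Ss) then at p within S else bot) else layered_over Ss p)"

definition layered :: "complex set list \<Rightarrow> picture" where
  "layered Ss = (\<Union>(set Ss), layered_over Ss)"

fun polyline :: "complex list \<Rightarrow> complex set" where
  "polyline [] = {}"
| "polyline [p] = {p}"
| "polyline (p # q # ps) = closed_segment p q \<union> polyline (q # ps)"


section \<open>Kauffman skein triples\<close>

text \<open>
  The overstrand of the crossing is horizontal.  Rotating it counterclockwise sweeps out the first
  and the third quadrant, which are joined by the \<open>A\<close>-smoothing.
\<close>

definition crossing_picture :: picture where
  "crossing_picture = layered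
     [polyline [Complex (-2) 0, Complex 2 0], polyline [Complex 0 (-2), Complex 0 2]]"

definition A_smoothing :: picture where
  "A_smoothing = layered
     [polyline [Complex (-2) 0, Complex 0 2], polyline [Complex 0 (-2), Complex 2 0]]"

definition B_smoothing :: picture where
  "B_smoothing = layered
     [polyline [Complex (-2) 0, Complex 0 (-2)], polyline [Complex 0 2, Complex 2 0]]"

definition kauffman_skein_triple :: "link_diagram \<Rightarrow> link_diagram \<Rightarrow> link_diagram \<Rightarrow> bool" where
  "kauffman_skein_triple D D0 Dinf \<longleftrightarrow>
     (\<exists>\<phi>. plane_isotopy \<phi> \<and>
        contains_picture \<phi> crossing_picture D \<and>
        contains_picture \<phi> A_smoothing D0 \<and>
        contains_picture \<phi> B_smoothing Dinf \<and>
        agree_outside \<phi> D D0 \<and> agree_outside \<phi> D Dinf)"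


section \<open>Reidemeister moves\<close>

text \<open>
  The kink runs along \<open>(-2,0), (-1,-1), (1,1), (-1,1), (1,-1), (2,0)\<close> and crosses itself in the
  origin.  One of its two branches there is the open segment \<open>kink1\<close> (open, so that it meets the
  rest \<open>kink2\<close> of the curve in the origin only).  The two layerings are the two crossing types.
  Kinks on the other side of the strand, and second moves with the roles of the strands
  exchanged, arise by a rotation of the plane by the angle \<open>\<pi>\<close>.
\<close>

definition unkinked :: picture where
  "unkinked = layered [polyline [Complex (-2) 0, Complex 2 0]]"

definition kink1 :: "complex set" where
  "kink1 = open_segment (Complex (-1) (-1)) (Complex 1 1)"

definition kink2 :: "complex set" where
  "kink2 = polyline [Complex (-2) 0, Complex (-1) (-1)] \<union>
           polyline [Complex 1 1, Complex (-1) 1, Complex 1 (-1), Complex 2 0]"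

definition adds_kink :: "link_diagram \<Rightarrow> link_diagram \<Rightarrow> bool" where
  "adds_kink D D' \<longleftrightarrow>
     replace_picture unkinked (layered [kink1, kink2]) D D' \<or>
     replace_picture unkinked (layered [kink2, kink1]) D D'"

definition reidemeister1 :: "link_diagram \<Rightarrow> link_diagram \<Rightarrow> bool" where
  "reidemeister1 D D' \<longleftrightarrow> adds_kink D D' \<or> adds_kink D' D"

definition reidemeister2 :: "link_diagram \<Rightarrow> link_diagram \<Rightarrow> bool" where
  "reidemeister2 = replace_picture
     (layered [polyline [Complex (-1) (-2), Complex (-1) 2],
               polyline [Complex 1 (-2), Complex 1 2]])
     (layered [polyline [Complex (-1) (-2), Complex 1 0, Complex (-1) 2],
               polyline [Complex 1 (-2), Complex (-1) 0, Complex 1 2]])"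

text \<open>
  In the third move the strand \<open>s\<close> is pushed across the crossing of the strands \<open>d\<close> and \<open>e\<close> from
  the position \<open>s = r3_above\<close> to \<open>s = r3_below\<close>; it may be the top, the middle or the bottom strand.
\<close>

definition r3_above :: "complex set" where
  "r3_above = polyline [Complex (-2) 0, Complex (-1) 1, Complex 1 1, Complex 2 0]"

definition r3_below :: "complex set" where
  "r3_below = polyline [Complex (-2) 0, Complex (-1) (-1), Complex 1 (-1), Complex 2 0]"

definition r3_diagonals :: "(complex set \<times> complex set) set" where
  "r3_diagonals =
     (let d = polyline [Complex (-1) (-2), Complex 1 2];
          e = polyline [Complex 1 (-2), Complex (-1) 2]
      in {(d, e), (e, d)})"

definition reidemeister3 :: "link_diagram \<Rightarrow> link_diagram \<Rightarrow> bool" where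
  "reidemeister3 D D' \<longleftrightarrow>
     (\<exists>(d, e) \<in> r3_diagonals.
        replace_picture (layered [r3_above, d, e]) (layered [r3_below, d, e]) D D' \<or>
        replace_picture (layered [d, r3_above, e]) (layered [d, r3_below, e]) D D' \<or>
        replace_picture (layered [d, e, r3_above]) (layered [d, e, r3_below]) D D')"


section \<open>Framed links and links\<close>

definition framed_equivalent :: "link_diagram \<Rightarrow> link_diagram \<Rightarrow> bool" where
  "framed_equivalent = equivclp (\<lambda>D D'.
     planar_isotopic D D' \<or> reidemeister2 D D' \<or> reidemeister3 D D')"

definition link_equivalent :: "link_diagram \<Rightarrow> link_diagram \<Rightarrow> bool" where
  "link_equivalent = equivclp (\<lambda>D D'.
     planar_isotopic D D' \<or> reidemeister1 D D' \<or> reidemeister2 D D' \<or> reidemeister3 D D')"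

quotient_type framed_link = link_diagram / framed_equivalent
  morphisms rep_framed_link framed_class
  by (simp add: framed_equivalent_def)

quotient_type link = link_diagram / link_equivalent
  morphisms rep_link link_class
  by (simp add: link_equivalent_def)

text \<open>
  By the theorem of Niebrzydowski and Przytycki, exactly one map satisfies the following
  for a given Kauffman bracket magma.  All crossingless diagrams with \<open>n\<close> components, nested or
  not, represent the same framed link.
\<close>

definition associated_invariant ::
  "('a \<Rightarrow> 'a \<Rightarrow> 'a) \<Rightarrow> (nat \<Rightarrow> 'a) \<Rightarrow> (framed_link \<Rightarrow> 'a) \<Rightarrow> bool" where
  "associated_invariant opr a P \<longleftrightarrow>
     (\<forall>n\<ge>1. \<forall>D. trivial_diagram n D \<longrightarrow> P (framed_class D) = a n) \<and>
     (\<forall>D D0 Dinf. kauffman_skein_triple D D0 Dinf \<longrightarrow>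
        P (framed_class D) = opr (P (framed_class D0)) (P (framed_class Dinf)))"

end

theory Submission
  imports Defs
begin

text \<open>The value \<rho>_D(P(D)) depends only on the framed class of \<open>D\<close>, so planar
  isotopy and the second and third Reidemeister moves preserve it; the hypothesis on \<rho> gives
  the same for the first move. These moves generate link equivalence, so the value descends to links
  (\<open>link_equivalent_invariant\<close>). Uniqueness holds because every link is the class of
  some diagram.\<close>

lemma framed_class_eqI:
  assumes "planar_isotopic D D' \<or> reidemeister2 D D' \<or> reidemeister3 D D'"
  shows "framed_class D = framed_class D'"
proof -
  have "framed_equivalent D D'"
    unfolding framed_equivalent_def using assms by (blast intro: r_into_equivclp)
  then show ?thesis by (simp add: framed_link.abs_eq_iff)
qed

text \<open>Equality of values of \<open>f\<close> is itself an equivalence relation, so it contains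
  link equivalence as soon as it contains the generating moves.\<close>

lemma link_equivalent_invariant:
  assumes "link_equivalent D D'"
    and framed: "\<And>D D'. framed_class D = framed_class D' \<Longrightarrow> f D = f D'"
    and reid1: "\<And>D D'. reidemeister1 D D' \<Longrightarrow> f D = f D'"
  shows "f D = f D'"
  using assms(1) unfolding link_equivalent_def
proof (induction rule: equivclp_induct)
  case base
  show ?case ..
next
  case (step E E')
  \<comment> \<open>The closure allows a generating move from \<open>E\<close> to \<open>E'\<close>
    or from \<open>E'\<close> to \<open>E\<close>; \<open>sym\<close> covers the reversed
    direction.\<close>
  have "f E = f E'"
    using step.hyps framed_class_eqI framed reid1 by (blast intro: sym)
  with step.IH show ?case by (rule trans)
qed

theorem theorem3p1:
  fixes opr :: "'a \<Rightarrow> 'a \<Rightarrow> 'a" and a :: "nat \<Rightarrow> 'a"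
    and P :: "framed_link \<Rightarrow> 'a" and \<rho> :: "framed_link \<Rightarrow> ('a \<Rightarrow> 'a)"
  assumes "kauffman_bracket_magma opr a"
    and "associated_invariant opr a P"
    and "\<And>D D'. reidemeister1 D D' \<Longrightarrow>
           \<rho> (framed_class D) (P (framed_class D)) = \<rho> (framed_class D') (P (framed_class D'))"
  shows "\<exists>!P\<rho> :: link \<Rightarrow> 'a. \<forall>D :: link_diagram.
           P\<rho> (link_class D) = \<rho> (framed_class D) (P (framed_class D))"
proof -
  define f where "f D = \<rho> (framed_class D) (P (framed_class D))" for D
  have f_eq: "f D = f D'" if "link_class D = link_class D'" for D D'
  proof (rule link_equivalent_invariant)
    show "link_equivalent D D'" using that by (simp add: link.abs_eq_iff)
  next
    show "f E = f E'" if "framed_class E = framed_class E'" for E E'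
      using that by (simp add: f_def)
  next
    show "f E = f E'" if "reidemeister1 E E'" for E E'
      unfolding f_def using that by (rule assms(3))
  qed
  have class_rep: "link_class (rep_link L) = L" for L
    by (rule Quotient_abs_rep[OF Quotient_link])
  have "\<exists>!Q. \<forall>D. Q (link_class D) = f D"
  proof (rule ex1I)
    \<comment> \<open>\<open>rep_link\<close> selects some diagram of the class, possibly not
      \<open>D\<close>; by \<open>f_eq\<close> the choice does not affect the value.\<close>
    show "\<forall>D. (f \<circ> rep_link) (link_class D) = f D"
      by (simp add: f_eq[OF class_rep])
  next
    fix Q assume "\<forall>D. Q (link_class D) = f D"
    \<comment> \<open>Each link is the class of its chosen representative, where the value of
      \<open>Q\<close> is prescribed.\<close>
    then show "Q = f \<circ> rep_link"
      by (intro ext) (metis class_rep comp_apply)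
  qed
  then show ?thesis unfolding f_def .
qed

end
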